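(* Let $T>0$, $K\ge0$, let $E,F$ be separable Hilbert spaces, let $\nu_0$ be a finite measure on $[-K,0]$ and let $k:[0,T]\times[-K,0]\to\mathcal L(E,F)$ be a weakly measurable operator-valued function such that $$M_0:=\sup_{t\in[0,T]}\int_{[-K,0]}\|k(t,s)\|_{\mathcal L(E,F)}\nu_0(ds)<\infty,\qquad M:=\sup_{t\in[-K,T]}\int_{[-K,0]}\|k(t-s,s)\|_{\mathcal L(E,F)}\mathbf 1_{[t-T,t]}(s)\,\nu_0(ds)<\infty .$$ Let $\varrho:L^2(-K,T;E)\to L^2(0,T;F)$ be the bounded linear operator $\varrho_t(Z)=\int_{[-K,0]}k(t,s)Z(t+s)\,\nu_0(ds)$, $t\in[0,T]$, and let $\varrho^*=\{\varrho^*_t(\cdot),\,t\in[-K,T]\}:L^2(0,T;F)\to L^2(-K,T;E)$ be its adjoint, i.e. $\int_0^T\langle\varrho_t(Z),Q(t)\rangle_Fdt=\int_{-K}^T\langle Z(t),\varrho_t^*(Q)\rangle_Edt$ for all $Z\in L^2(-K,T;E)$, $Q\in L^2(0,T;F)$. Then, for every $Q\in L^2(0,T;F)$, $$\varrho_t^*(Q)=\int_{[-K,0]}k^*(t-s,s)\,Q(t-s)\,\mathbf 1_{[t-T,t]}(s)\,\nu_0(ds),\qquad t\in[-K,T]$$ (as elements of $L^2(-K,T;E)$), where $k^*(t,s)\in\mathcal L(F,E)$ is the adjoint operator of $k(t,s)$. Moreover, for each $K'\in[-K,T]$, $$\int_{K'}^T\|\varrho_t^*(Q)\|_E^2\,dt\le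 MM_0\int_{0\vee K'}^T\|Q(u)\|_F^2\,du\qquad\text{for all }Q\in L^2(0,T;F).$$
   Context: Weakly measurable means that $(t,s)\mapsto\langle k(t,s)e,f\rangle_F$ is measurable for all $e\in E$, $f\in F$. Integrands containing the factor $\mathbf 1_{[t-T,t]}(s)$ are understood to be $0$ when $t-s\notin[0,T]$. Under the stated hypotheses $\varrho_t(Z)$ is a well-defined Bochner integral for almost all $t\in[0,T]$ and $\varrho$ is a bounded linear operator from $L^2(-K,T;E)$ to $L^2(0,T;F)$. *)

theory Defs
  imports "HOL-Analysis.Analysis"
begin

text \<open>
  Elements of \<open>L\<^sup>2(M;E)\<close> are represented by \<open>M\<close>-measurable functions and are compared only
  almost everywhere. The intervals below carry the Borel \<open>\<sigma>\<close>-algebra, so representatives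
  are Borel: for a merely Lebesgue measurable \<open>Z\<close> the map \<open>s \<mapsto> Z (t + s)\<close> need not be
  measurable for a measure on the Borel sets that has atoms, and the Bochner integral
  would then silently be \<open>0\<close>.
\<close>

definition square_integrable :: "'a measure \<Rightarrow> ('a \<Rightarrow> 'b::{real_inner, banach, second_countable_topology}) set"
  where "square_integrable M =
    {f \<in> borel_measurable M. integrable M (\<lambda>x. (norm (f x))\<^sup>2)}"

definition L2_norm :: "'a measure \<Rightarrow> ('a \<Rightarrow> 'b::{real_inner, banach, second_countable_topology}) \<Rightarrow> real"
  where "L2_norm M f = sqrt (\<integral>x. (norm (f x))\<^sup>2 \<partial>M)"

abbreviation interval_measure_on :: "real \<Rightarrow> real \<Rightarrow> real measure"
  where "interval_measure_on a b \<equiv> restrict_space lborel {a..b}"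

text \<open>Boundedness together with linearity makes the operator well defined on
  almost-everywhere equivalence classes.\<close>

definition L2_bounded_linear ::
  "'a measure \<Rightarrow> 'b measure \<Rightarrow>
   (('a \<Rightarrow> 'e::{real_inner, banach, second_countable_topology}) \<Rightarrow>
    ('b \<Rightarrow> 'f::{real_inner, banach, second_countable_topology})) \<Rightarrow> bool"
  where "L2_bounded_linear M N R \<longleftrightarrow>
    (\<forall>Z \<in> square_integrable M. R Z \<in> square_integrable N) \<and>
    (\<forall>Y \<in> square_integrable M. \<forall>Z \<in> square_integrable M. \<forall>c d :: real.
       AE t in N. R (\<lambda>x. c *\<^sub>R Y x + d *\<^sub>R Z x) t = c *\<^sub>R R Y t + d *\<^sub>R R Z t) \<and>
    (\<exists>C. \<forall>Z \<in> square_integrable M. L2_norm N (R Z) \<le> C * L2_norm M Z)"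

definition is_L2_adjoint ::
  "'a measure \<Rightarrow> 'b measure \<Rightarrow>
   (('a \<Rightarrow> 'e::{real_inner, banach, second_countable_topology}) \<Rightarrow>
    ('b \<Rightarrow> 'f::{real_inner, banach, second_countable_topology})) \<Rightarrow>
   (('b \<Rightarrow> 'f) \<Rightarrow> ('a \<Rightarrow> 'e)) \<Rightarrow> bool"
  where "is_L2_adjoint M N R S \<longleftrightarrow>
    (\<forall>Q \<in> square_integrable N. S Q \<in> square_integrable M) \<and>
    (\<forall>Z \<in> square_integrable M. \<forall>Q \<in> square_integrable N.
       (\<integral>t. inner (R Z t) (Q t) \<partial>N) = (\<integral>t. inner (Z t) (S Q t) \<partial>M))"

definition weakly_measurable_on ::
  "(real \<times> real) set \<Rightarrow> (real \<Rightarrow> real \<Rightarrow> 'e::real_inner \<Rightarrow>\<^sub>L 'f::real_inner) \<Rightarrow> bool"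
  where "weakly_measurable_on A k \<longleftrightarrow>
    (\<forall>e f. (\<lambda>(t, s). inner (blinfun_apply (k t s) e) f) \<in> borel_measurable (restrict_space borel A))"

definition delay_operator ::
  "real measure \<Rightarrow>
   (real \<Rightarrow> real \<Rightarrow> 'e::{real_inner, banach, second_countable_topology} \<Rightarrow>\<^sub>L
                    'f::{real_inner, banach, second_countable_topology}) \<Rightarrow>
   (real \<Rightarrow> 'e) \<Rightarrow> real \<Rightarrow> 'f"
  where "delay_operator \<nu> k Z t = (\<integral>s. blinfun_apply (k t s) (Z (t + s)) \<partial>\<nu>)"

end

theory Submission
  imports Defs
begin

text \<open>
  Extend the kernel, \<open>Z\<close> and \<open>Q\<close> by zero to the whole line. By Cauchy--Schwarz in \<open>s\<close> with weight
  \<open>\<parallel>k(t,s)\<parallel>\<close>, \<open>(\<integral>\<parallel>k(t,s)\<parallel> \<parallel>Z(t+s)\<parallel> \<nu>\<^sub>0(ds))\<^sup>2 \<le> M\<^sub>0 \<integral>\<parallel>k(t,s)\<parallel> \<parallel>Z(t+s)\<parallel>\<^sup>2 \<nu>\<^sub>0(ds)\<close>; integrating in \<open>t\<close> and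
  substituting \<open>u = t + s\<close> bounds the square of the \<open>L\<^sup>2\<close> norm by \<open>M\<^sub>0 M \<parallel>Z\<parallel>\<^sup>2\<close>. The same absolute bound
  justifies Fubini, and the shear \<open>(t, s) \<mapsto> (t + s, s)\<close> of the double integral of
  \<open>\<langle>k(t,s) Z(t+s), Q(t)\<rangle>\<close> identifies the adjoint, to which the same estimate applies.
  Since \<open>s \<le> 0\<close>, its values at times \<open>\<ge> K'\<close> depend only on \<open>Q\<close> at times \<open>\<ge> max 0 K'\<close>.
\<close>

subsection \<open>Adjoints and weak measurability in separable Hilbert spaces\<close>

text \<open>The representing vector is the minimiser of the quadratic functional \<open>J\<close>:
  minimising sequences are Cauchy by the parallelogram law, completeness gives a limit, and the
  first variation there must vanish.\<close>

lemma Riesz_representation: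
  fixes g :: "'a::{real_inner, banach} \<Rightarrow> real"
  assumes "bounded_linear g"
  obtains x where "\<And>y. g y = inner x y"
proof -
  interpret g: bounded_linear g by fact
  define J where "J x = (norm x)\<^sup>2 - 2 * g x" for x
  obtain C where C: "\<And>x. \<bar>g x\<bar> \<le> norm x * C"
    using g.bounded by auto
  have "- C\<^sup>2 \<le> J x" for x
  proof -
    have "0 \<le> (norm x - C)\<^sup>2" by simp
    then have "2 * (norm x * C) \<le> (norm x)\<^sup>2 + C\<^sup>2"
      by (simp add: power2_diff)
    with C[of x] show ?thesis unfolding J_def by linarith
  qed
  then have bdd: "bdd_below (range J)" by (intro bdd_belowI2)
  define m where "m = Inf (range J)"
  have m: "m \<le> J x" for x
    unfolding m_def by (rule cInf_lower[OF rangeI bdd])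
  have "\<exists>x. J x < m + inverse (real (Suc n))" for n
  proof -
    have "Inf (range J) < m + inverse (real (Suc n))"
      unfolding m_def by simp
    then show ?thesis
      by (subst (asm) cInf_less_iff[OF _ bdd]) auto
  qed
  then obtain X where X: "\<And>n. J (X n) < m + inverse (real (Suc n))" by metis
  \<comment> \<open>Parallelogram law: the value of \<open>J\<close> at the midpoint falls short of
    the average of \<open>J x\<close> and \<open>J y\<close> by a quarter of the squared distance,
    yet is at least \<open>m\<close>.\<close>
  have par: "(norm (x - y))\<^sup>2 \<le> 2 * (J x - m) + 2 * (J y - m)" for x y
  proof -
    have "2 * J ((1/2) *\<^sub>R (x + y)) = J x + J y - (norm (x - y))\<^sup>2 / 2"
      unfolding J_def power2_norm_eq_inner g.scaleR g.add
      by (simp add: inner_simps inner_commute field_simps)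
    with m[of "(1/2) *\<^sub>R (x + y)"] show ?thesis by (simp add: field_simps)
  qed
  have "Cauchy X"
  proof (rule metric_CauchyI)
    fix e :: real assume "e > 0"
    \<comment> \<open>With both excesses \<open>J (X i) - m\<close> and \<open>J (X j) - m\<close>
      below \<open>e\<^sup>2 / 4\<close>, \<open>par\<close> bounds the squared distance by
      \<open>e\<^sup>2\<close>.\<close>
    then obtain n where n: "inverse (real (Suc n)) < e\<^sup>2 / 4"
      using reals_Archimedean[of "e\<^sup>2 / 4"] by auto
    have "dist (X i) (X j) < e" if "i \<ge> n" "j \<ge> n" for i j
    proof -
      have "J (X i') - m < e\<^sup>2 / 4" if "i' \<ge> n" for i'
      proof -
        have "inverse (real (Suc i')) \<le> inverse (real (Suc n))"
          using that by (intro le_imp_inverse_le) auto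
        with X[of i'] n show ?thesis by linarith
      qed
      from this[OF that(1)] this[OF that(2)] par[of "X i" "X j"]
      have "(norm (X i - X j))\<^sup>2 < e\<^sup>2" by (simp add: field_simps)
      then show ?thesis
        using \<open>e > 0\<close> by (simp add: dist_norm power2_less_imp_less)
    qed
    then show "\<exists>n. \<forall>i\<ge>n. \<forall>j\<ge>n. dist (X i) (X j) < e" by blast
  qed
  then obtain x where x: "X \<longlonglongrightarrow> x"
    using Cauchy_convergent convergent_def by blast
  have "J x \<le> m"
  proof (rule LIMSEQ_le)
    show "(\<lambda>n. J (X n)) \<longlonglongrightarrow> J x"
      unfolding J_def by (intro tendsto_intros g.tendsto x)
    show "(\<lambda>n. m + inverse (real (Suc n))) \<longlonglongrightarrow> m"
      using LIMSEQ_inverse_real_of_nat_add .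
    show "\<exists>N. \<forall>n\<ge>N. J (X n) \<le> m + inverse (real (Suc n))"
      using X less_imp_le by blast
  qed
  have "g y = inner x y" for y
  proof (rule ccontr)
    assume ne: "g y \<noteq> inner x y"
    \<comment> \<open>A step of length \<open>t\<close> along \<open>y\<close> changes
      \<open>J\<close> by \<open>2 * t * a + t\<^sup>2 * n\<close>. The optimal step would be
      \<open>- a / n\<close>; the denominator \<open>n + 1\<close> is never zero and still makes
      \<open>J\<close> drop below its minimum.\<close>
    define a n t where "a = inner x y - g y" and "n = (norm y)\<^sup>2" and "t = - a / (n + 1)"
    have n: "n \<ge> 0" and a: "a \<noteq> 0" using ne by (auto simp: n_def a_def)
    have "J (x + t *\<^sub>R y) = J x + (2 * t * a + t\<^sup>2 * n)"
      unfolding J_def n_def a_def power2_norm_eq_inner g.scaleR g.add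
      by (simp add: inner_simps inner_commute field_simps power2_eq_square)
    moreover have "a = - t * (n + 1)"
      using n by (simp add: t_def)
    then have "2 * t * a + t\<^sup>2 * n = - (t\<^sup>2 * (n + 2))"
      by (simp only:) (simp add: algebra_simps power2_eq_square)
    moreover have "t\<^sup>2 * (n + 2) > 0"
      using n a by (auto simp: t_def)
    ultimately show False
      using m[of "x + t *\<^sub>R y"] \<open>J x \<le> m\<close> by linarith
  qed
  then show thesis by (rule that)
qed

text \<open>\<open>adjoint\<close> is an arbitrary choice among the maps with this property, so the
  point is existence: Riesz represents \<open>x \<mapsto> inner (A x) y\<close> for each
  \<open>y\<close>.\<close>

lemma inner_adjoint_right:
  fixes A :: "'a::{real_inner, banach} \<Rightarrow>\<^sub>L 'b::real_inner"
  shows "inner x (adjoint (blinfun_apply A) y) = inner (blinfun_apply A x) y"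
proof -
  have "\<exists>w. \<forall>x. inner (blinfun_apply A x) y = inner x w" for y
  proof -
    have "bounded_linear (\<lambda>x. inner (blinfun_apply A x) y)"
      by (rule bounded_linear_compose[OF bounded_linear_inner_left blinfun.bounded_linear_right])
    from Riesz_representation[OF this] obtain w
      where "\<And>x. inner (blinfun_apply A x) y = inner w x"
      by metis
    then show ?thesis
      by (metis inner_commute)
  qed
  then have "\<exists>f'. \<forall>x y. inner (blinfun_apply A x) y = inner x (f' y)"
    using choice[of "\<lambda>y w. \<forall>x. inner (blinfun_apply A x) y = inner x w"] by blast
  from someI_ex[OF this] have "\<forall>x y. inner (blinfun_apply A x) y = inner x (adjoint (blinfun_apply A) y)"
    unfolding adjoint_def .
  then show ?thesis by metis
qed

text \<open>Insert the vector \<open>w = adjoint A y\<close> itself into the adjoint identity, apply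
  Cauchy-Schwarz, and cancel one factor \<open>norm w\<close>.\<close>

lemma norm_adjoint_le:
  fixes A :: "'a::{real_inner, banach} \<Rightarrow>\<^sub>L 'b::real_inner"
  shows "norm (adjoint (blinfun_apply A) y) \<le> norm y * norm A"
proof -
  define w where "w = adjoint (blinfun_apply A) y"
  have "(norm w)\<^sup>2 = inner (blinfun_apply A w) y"
    unfolding power2_norm_eq_inner using inner_adjoint_right[of w A y] by (simp only: w_def)
  also have "\<dots> \<le> norm (blinfun_apply A w) * norm y" by (rule norm_cauchy_schwarz)
  also have "\<dots> \<le> (norm A * norm w) * norm y"
    by (intro mult_right_mono norm_blinfun) simp
  finally have "norm w * norm w \<le> norm w * (norm y * norm A)"
    by (simp add: power2_eq_square ac_simps)
  then have "norm w \<le> norm y * norm A"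
    by (metis mult_le_cancel_left_pos mult_nonneg_nonneg norm_ge_zero order_le_less)
  then show ?thesis by (simp add: w_def)
qed

lemma bounded_linear_adjoint:
  fixes A :: "'a::{real_inner, banach} \<Rightarrow>\<^sub>L 'b::real_inner"
  shows "bounded_linear (adjoint (blinfun_apply A))"
proof (rule bounded_linear_intro[OF _ _ norm_adjoint_le])
  show "adjoint (blinfun_apply A) (x + y) =
      adjoint (blinfun_apply A) x + adjoint (blinfun_apply A) y" for x y
    by (rule vector_eq_ldot[THEN iffD1]) (simp add: inner_adjoint_right inner_add_right)
  show "adjoint (blinfun_apply A) (r *\<^sub>R x) = r *\<^sub>R adjoint (blinfun_apply A) x" for r x
    by (rule vector_eq_ldot[THEN iffD1]) (simp add: inner_adjoint_right)
qed

text \<open>Bundled as a bounded operator, the adjoint kernel can instantiate the same locale as the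
  kernel itself.\<close>

definition blinfun_adjoint ::
    "('a::{real_inner, banach} \<Rightarrow>\<^sub>L 'b::real_inner) \<Rightarrow> ('b \<Rightarrow>\<^sub>L 'a)" where
  "blinfun_adjoint A = Blinfun (adjoint (blinfun_apply A))"

lemma blinfun_apply_adjoint:
  "blinfun_apply (blinfun_adjoint A) = adjoint (blinfun_apply A)"
  unfolding blinfun_adjoint_def by (rule bounded_linear_Blinfun_apply[OF bounded_linear_adjoint])

lemma inner_blinfun_adjoint:
  "inner (blinfun_apply (blinfun_adjoint A) y) x = inner y (blinfun_apply A x)"
  unfolding blinfun_apply_adjoint
  by (metis inner_adjoint_right inner_commute)

lemma norm_blinfun_adjoint_le: "norm (blinfun_adjoint A) \<le> norm A"
  by (rule norm_blinfun_bound[OF norm_ge_zero])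
    (metis blinfun_apply_adjoint mult.commute norm_adjoint_le)

section \<open>Measurability tests through countable dense sets\<close>

text \<open>By second countability an open set is a countable union of balls with rational radii and
  centres in a dense set, and the preimage of a ball is a strict sublevel set of a distance
  function.\<close>

lemma borel_measurable_of_dist:
  fixes f :: "'a \<Rightarrow> 'b::{metric_space, second_countable_topology}"
  assumes "\<And>a. (\<lambda>x. dist (f x) a) \<in> borel_measurable M"
  shows "f \<in> borel_measurable M"
proof (rule borel_measurableI)
  fix S :: "'b set" assume S: "open S"
  obtain D :: "'b set" where D: "countable D" "\<And>X. open X \<Longrightarrow> X \<noteq> {} \<Longrightarrow> \<exists>d \<in> D. d \<in> X"
    using countable_dense_setE by blast
  define I where "I = {(d, q). d \<in> D \<and> q \<in> \<rat> \<and> ball d q \<subseteq> S}"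
  have "countable (D \<times> \<rat>)" using D(1) countable_rat by blast
  then have "countable I"
    by (rule countable_subset[rotated]) (auto simp: I_def)
  have cover: "\<exists>(d, q)\<in>I. dist z d < q" if "z \<in> S" for z
  proof -
    obtain e where e: "e > 0" "ball z e \<subseteq> S"
      using S \<open>z \<in> S\<close> open_contains_ball by blast
    \<comment> \<open>The centre \<open>d\<close> is within \<open>e / 3\<close> of
      \<open>z\<close>. A radius between \<open>e / 3\<close> and \<open>e / 2\<close> then catches
      \<open>z\<close>, and the ball stays in \<open>ball z e\<close> because
      \<open>e / 3 + e / 2 < e\<close>.\<close>
    obtain d where d: "d \<in> D" "d \<in> ball z (e / 3)"
      using D(2)[of "ball z (e / 3)"] e(1) by auto
    obtain q where q: "q \<in> \<rat>" "e / 3 < q" "q < e / 2"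
      using Rats_dense_in_real[of "e / 3" "e / 2"] e(1) by auto
    have "ball d q \<subseteq> ball z e"
    proof
      fix w assume "w \<in> ball d q"
      with d(2) q(3) e(1) dist_triangle[of z w d] show "w \<in> ball z e" by simp
    qed
    with e d q show ?thesis
      by (intro bexI[of _ "(d, q)"]) (auto simp: I_def)
  qed
  have "f -` S \<inter> space M = (\<Union>(d, q)\<in>I. {x \<in> space M. dist (f x) d < q})"
  proof (intro equalityI subsetI)
    fix x assume "x \<in> f -` S \<inter> space M"
    with cover[of "f x"] show "x \<in> (\<Union>(d, q)\<in>I. {x \<in> space M. dist (f x) d < q})" by auto
  next
    fix x assume "x \<in> (\<Union>(d, q)\<in>I. {x \<in> space M. dist (f x) d < q})"
    then show "x \<in> f -` S \<inter> space M" by (auto simp: I_def dist_commute)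
  qed
  also have "\<dots> \<in> sets M"
    using \<open>countable I\<close> assms
    by (intro sets.countable_UN'') (auto intro!: borel_measurable_less)
  finally show "f -` S \<inter> space M \<in> sets M" .
qed

text \<open>Violating the inequality is an open condition on the test vector, so a violation
  anywhere would also occur in \<open>D\<close>; testing with \<open>v\<close> itself then bounds
  its norm. A norm bound thus becomes countably many scalar conditions when \<open>D\<close> is
  countable.\<close>

lemma norm_le_iff_dense:
  fixes D :: "'a::real_inner set"
  assumes "\<And>X. open X \<Longrightarrow> X \<noteq> {} \<Longrightarrow> \<exists>d \<in> D. d \<in> X"
    and "0 \<le> r"
  shows "norm v \<le> r \<longleftrightarrow> (\<forall>d\<in>D. inner v d \<le> r * norm d)"
proof (intro iffI ballI)
  fix d assume "norm v \<le> r"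
  then show "inner v d \<le> r * norm d"
    using norm_cauchy_schwarz[of v d] mult_right_mono[of "norm v" r "norm d"] by simp
next
  assume *: "\<forall>d\<in>D. inner v d \<le> r * norm d"
  have "inner v x \<le> r * norm x" for x
  proof (rule ccontr)
    assume "\<not> ?thesis"
    moreover have "open {x. r * norm x < inner v x}"
      by (intro open_Collect_less continuous_intros)
    ultimately show False using assms(1)[of "{x. r * norm x < inner v x}"] * by (fastforce simp: not_le)
  qed
  from this[of v] \<open>0 \<le> r\<close> show "norm v \<le> r"
    by (cases "v = 0") (simp_all add: power2_eq_square flip: power2_norm_eq_inner)
qed

text \<open>The same openness argument, now for the operator norm.\<close>

lemma norm_blinfun_le_iff_dense:
  fixes D :: "'a::real_normed_vector set" and A :: "'a \<Rightarrow>\<^sub>L 'b::real_normed_vector"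
  assumes "\<And>X. open X \<Longrightarrow> X \<noteq> {} \<Longrightarrow> \<exists>d \<in> D. d \<in> X"
    and "0 \<le> r"
  shows "norm A \<le> r \<longleftrightarrow> (\<forall>d\<in>D. norm (blinfun_apply A d) \<le> r * norm d)"
proof (intro iffI ballI)
  fix d assume "norm A \<le> r"
  then show "norm (blinfun_apply A d) \<le> r * norm d"
    using norm_blinfun[of A d] mult_right_mono[of "norm A" r "norm d"] by simp
next
  assume *: "\<forall>d\<in>D. norm (blinfun_apply A d) \<le> r * norm d"
  have "norm (blinfun_apply A x) \<le> r * norm x" for x
  proof (rule ccontr)
    assume "\<not> ?thesis"
    moreover have "open {x. r * norm x < norm (blinfun_apply A x)}"
      by (intro open_Collect_less continuous_intros)
    ultimately show False
      using assms(1)[of "{x. r * norm x < norm (blinfun_apply A x)}"] * by (fastforce simp: not_le)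
  qed
  with \<open>0 \<le> r\<close> show "norm A \<le> r" by (intro norm_blinfun_bound)
qed

text \<open>Pettis' theorem for separable inner product spaces: the preimage of a closed ball is a
  countable intersection of sets given by scalar measurable functions.\<close>

lemma borel_measurable_of_weakly:
  fixes f :: "'a \<Rightarrow> 'b::{real_inner, second_countable_topology}"
  assumes [measurable]: "\<And>y. (\<lambda>x. inner (f x) y) \<in> borel_measurable M"
  shows "f \<in> borel_measurable M"
proof (rule borel_measurable_of_dist)
  fix a
  obtain D :: "'b set" where D: "countable D" "\<And>X. open X \<Longrightarrow> X \<noteq> {} \<Longrightarrow> \<exists>d \<in> D. d \<in> X"
    using countable_dense_setE by blast
  have "{x \<in> space M. norm (f x - a) \<le> r} \<in> sets M" for r
  proof (cases "0 \<le> r")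
    case True
    have "{x \<in> space M. norm (f x - a) \<le> r} =
        {x \<in> space M. \<forall>d\<in>D. inner (f x) d - inner a d \<le> r * norm d}"
      by (simp add: norm_le_iff_dense[OF D(2) True] inner_diff_left)
    also have "\<dots> \<in> sets M"
      using D(1) by measurable
    finally show ?thesis .
  next
    case False
    then have "{x \<in> space M. norm (f x - a) \<le> r} = {}"
      by (auto intro: order_trans[OF norm_ge_zero])
    then show ?thesis by (simp only: sets.empty_sets)
  qed
  then show "(\<lambda>x. dist (f x) a) \<in> borel_measurable M"
    unfolding borel_measurable_iff_le dist_norm by blast
qed

text \<open>A sublevel set of the operator norm is a countable intersection over dense test vectors,
  so measurability on each fixed vector is enough. This makes the kernel norm an admissible weight
  for Tonelli.\<close>

lemma borel_measurable_blinfun_norm: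
  fixes h :: "'a \<Rightarrow> 'b::{real_normed_vector, second_countable_topology} \<Rightarrow>\<^sub>L 'c::real_normed_vector"
  assumes [measurable]: "\<And>e. (\<lambda>x. blinfun_apply (h x) e) \<in> borel_measurable M"
  shows "(\<lambda>x. norm (h x)) \<in> borel_measurable M"
proof -
  obtain D :: "'b set" where D: "countable D" "\<And>X. open X \<Longrightarrow> X \<noteq> {} \<Longrightarrow> \<exists>d \<in> D. d \<in> X"
    using countable_dense_setE by blast
  have "{x \<in> space M. norm (h x) \<le> r} \<in> sets M" for r
  proof (cases "0 \<le> r")
    case True
    have "{x \<in> space M. norm (h x) \<le> r} =
        {x \<in> space M. \<forall>d\<in>D. norm (blinfun_apply (h x) d) \<le> r * norm d}"
      by (simp add: norm_blinfun_le_iff_dense[OF D(2) True])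
    also have "\<dots> \<in> sets M"
      using D(1) by measurable
    finally show ?thesis .
  next
    case False
    then have "{x \<in> space M. norm (h x) \<le> r} = {}"
      by (auto intro: order_trans[OF norm_ge_zero])
    then show ?thesis by (simp only: sets.empty_sets)
  qed
  then show ?thesis
    unfolding borel_measurable_iff_le by blast
qed

text \<open>Weak measurability of the kernel gives strong measurability of its adjoint on constant
  vectors, and a pairing of two strongly measurable functions is measurable; hence the kernel may
  also be applied to a measurable function.\<close>

lemma borel_measurable_weak_blinfun_apply:
  fixes h :: "'a \<Rightarrow> 'b::{real_inner, banach, second_countable_topology} \<Rightarrow>\<^sub>L
                     'c::{real_inner, second_countable_topology}"
  assumes [measurable]: "\<And>e f. (\<lambda>x. inner (blinfun_apply (h x) e) f) \<in> borel_measurable M"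
    and [measurable]: "z \<in> borel_measurable M"
  shows "(\<lambda>x. blinfun_apply (h x) (z x)) \<in> borel_measurable M"
proof (rule borel_measurable_of_weakly)
  fix y
  have [measurable]: "(\<lambda>x. blinfun_apply (blinfun_adjoint (h x)) y) \<in> borel_measurable M"
    by (rule borel_measurable_of_weakly) (simp add: inner_blinfun_adjoint inner_commute[of y])
  have "(\<lambda>x. inner (blinfun_apply (blinfun_adjoint (h x)) y) (z x)) \<in> borel_measurable M"
    by measurable
  then show "(\<lambda>x. inner (blinfun_apply (h x) (z x)) y) \<in> borel_measurable M"
    by (simp add: inner_blinfun_adjoint inner_commute[of y])
qed

subsection \<open>Shears of the plane and the Schur test\<close>

text \<open>Integrate over \<open>t\<close> first: for fixed \<open>s\<close> the shear is a
  translation, which preserves Lebesgue measure. Measurability of the identity on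
  \<open>\<nu>\<close> is what makes the shear itself measurable.\<close>

lemma nn_integral_shear:
  fixes \<nu> :: "real measure"
  assumes "sigma_finite_measure \<nu>" and [measurable]: "(\<lambda>s. s) \<in> borel_measurable \<nu>"
    and [measurable]: "F \<in> borel_measurable (borel \<Otimes>\<^sub>M \<nu>)"
  shows "(\<integral>\<^sup>+ p. F (fst p - c * snd p, snd p) \<partial>(lborel \<Otimes>\<^sub>M \<nu>)) = (\<integral>\<^sup>+ p. F p \<partial>(lborel \<Otimes>\<^sub>M \<nu>))"
proof -
  interpret \<nu>: sigma_finite_measure \<nu> by fact
  interpret pair_sigma_finite lborel \<nu> ..
  have "(\<integral>\<^sup>+ p. F (fst p - c * snd p, snd p) \<partial>(lborel \<Otimes>\<^sub>M \<nu>)) =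
      (\<integral>\<^sup>+ s. \<integral>\<^sup>+ t. F (t - c * s, s) \<partial>lborel \<partial>\<nu>)"
    by (subst nn_integral_snd[symmetric]) simp_all
  also have "\<dots> = (\<integral>\<^sup>+ s. \<integral>\<^sup>+ t. F (t, s) \<partial>lborel \<partial>\<nu>)"
  proof (rule nn_integral_cong)
    fix s assume "s \<in> space \<nu>"
    then have "(\<lambda>t. F (t, s)) \<in> borel_measurable borel" by simp
    from nn_integral_real_affine[OF this, of 1 "- c * s"]
    show "(\<integral>\<^sup>+ t. F (t - c * s, s) \<partial>lborel) = (\<integral>\<^sup>+ t. F (t, s) \<partial>lborel)"
      by (simp add: one_ennreal_def[symmetric])
  qed
  also have "\<dots> = (\<integral>\<^sup>+ p. F p \<partial>(lborel \<Otimes>\<^sub>M \<nu>))"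
    by (subst nn_integral_snd[symmetric]) simp_all
  finally show ?thesis .
qed

text \<open>The measure-preserving form of the shear, through which it applies to integrals of
  signed functions as well.\<close>

lemma distr_shear:
  fixes \<nu> :: "real measure"
  assumes "sigma_finite_measure \<nu>" and [measurable]: "(\<lambda>s. s) \<in> borel_measurable \<nu>"
  shows "distr (lborel \<Otimes>\<^sub>M \<nu>) (lborel \<Otimes>\<^sub>M \<nu>) (\<lambda>p. (fst p - c * snd p, snd p)) = lborel \<Otimes>\<^sub>M \<nu>"
proof (rule measure_eqI)
  fix X assume "X \<in> sets (distr (lborel \<Otimes>\<^sub>M \<nu>) (lborel \<Otimes>\<^sub>M \<nu>) (\<lambda>p. (fst p - c * snd p, snd p)))"
  then have X[measurable]: "X \<in> sets (borel \<Otimes>\<^sub>M \<nu>)" by simp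
  have "emeasure (distr (lborel \<Otimes>\<^sub>M \<nu>) (lborel \<Otimes>\<^sub>M \<nu>) (\<lambda>p. (fst p - c * snd p, snd p))) X =
      (\<integral>\<^sup>+ p. indicator X (fst p - c * snd p, snd p) \<partial>(lborel \<Otimes>\<^sub>M \<nu>))"
    by (subst nn_integral_indicator[symmetric], simp, subst nn_integral_distr) simp_all
  also have "\<dots> = emeasure (lborel \<Otimes>\<^sub>M \<nu>) X"
    by (subst nn_integral_shear[OF assms]) simp_all
  finally show "emeasure (distr (lborel \<Otimes>\<^sub>M \<nu>) (lborel \<Otimes>\<^sub>M \<nu>) (\<lambda>p. (fst p - c * snd p, snd p))) X =
      emeasure (lborel \<Otimes>\<^sub>M \<nu>) X" .
qed simp

text \<open>Schur test: write \<open>G = sqrt G * sqrt G\<close> and apply Cauchy--Schwarz to the inner integral.\<close>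

lemma nn_integral_shear_kernel_bound:
  fixes \<nu> :: "real measure" and G :: "real \<Rightarrow> real \<Rightarrow> real" and z :: "real \<Rightarrow> ennreal"
  assumes "sigma_finite_measure \<nu>" and [measurable]: "(\<lambda>s. s) \<in> borel_measurable \<nu>"
    and [measurable]: "case_prod G \<in> borel_measurable (borel \<Otimes>\<^sub>M \<nu>)"
    and [measurable]: "z \<in> borel_measurable borel"
    and nonneg: "\<And>t s. 0 \<le> G t s"
    and A: "\<And>t. (\<integral>\<^sup>+ s. G t s \<partial>\<nu>) \<le> A"
    and B: "\<And>u. (\<integral>\<^sup>+ s. G (u - c * s) s \<partial>\<nu>) \<le> B"
  shows "(\<integral>\<^sup>+ t. (\<integral>\<^sup>+ s. G t s * z (t + c * s) \<partial>\<nu>)\<^sup>2 \<partial>lborel) \<le> A * B * (\<integral>\<^sup>+ u. (z u)\<^sup>2 \<partial>lborel)"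
proof -
  interpret \<nu>: sigma_finite_measure \<nu> by fact
  have sq: "ennreal (sqrt (G t s)) * ennreal (sqrt (G t s)) = ennreal (G t s)" for t s
    using nonneg[of t s] by (simp flip: ennreal_mult)
  have "(\<integral>\<^sup>+ s. G t s * z (t + c * s) \<partial>\<nu>)\<^sup>2 \<le> A * (\<integral>\<^sup>+ s. G t s * (z (t + c * s))\<^sup>2 \<partial>\<nu>)" for t
  proof -
    have "(\<integral>\<^sup>+ s. G t s * z (t + c * s) \<partial>\<nu>)\<^sup>2 =
        (\<integral>\<^sup>+ s. ennreal (sqrt (G t s)) * (ennreal (sqrt (G t s)) * z (t + c * s)) \<partial>\<nu>)\<^sup>2"
      by (simp add: sq flip: mult.assoc)
    also have "\<dots> \<le> (\<integral>\<^sup>+ s. (ennreal (sqrt (G t s)))\<^sup>2 \<partial>\<nu>) *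
        (\<integral>\<^sup>+ s. (ennreal (sqrt (G t s)) * z (t + c * s))\<^sup>2 \<partial>\<nu>)"
      by (rule Cauchy_Schwarz_nn_integral) measurable
    also have "\<dots> = (\<integral>\<^sup>+ s. G t s \<partial>\<nu>) * (\<integral>\<^sup>+ s. G t s * (z (t + c * s))\<^sup>2 \<partial>\<nu>)"
      by (simp add: power_mult_distrib) (simp add: power2_eq_square sq)
    also have "\<dots> \<le> A * (\<integral>\<^sup>+ s. G t s * (z (t + c * s))\<^sup>2 \<partial>\<nu>)"
      by (intro mult_right_mono A) simp
    finally show ?thesis .
  qed
  then have "(\<integral>\<^sup>+ t. (\<integral>\<^sup>+ s. G t s * z (t + c * s) \<partial>\<nu>)\<^sup>2 \<partial>lborel) \<le>
      (\<integral>\<^sup>+ t. A * (\<integral>\<^sup>+ s. G t s * (z (t + c * s))\<^sup>2 \<partial>\<nu>) \<partial>lborel)"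
    by (intro nn_integral_mono)
  also have "\<dots> = A * (\<integral>\<^sup>+ t. \<integral>\<^sup>+ s. G t s * (z (t + c * s))\<^sup>2 \<partial>\<nu> \<partial>lborel)"
    by (rule nn_integral_cmult) measurable
  also have "(\<integral>\<^sup>+ t. \<integral>\<^sup>+ s. G t s * (z (t + c * s))\<^sup>2 \<partial>\<nu> \<partial>lborel) =
      (\<integral>\<^sup>+ p. G (fst p) (snd p) * (z (fst p + c * snd p))\<^sup>2 \<partial>(lborel \<Otimes>\<^sub>M \<nu>))"
    by (subst \<nu>.nn_integral_fst[symmetric]) simp_all
  \<comment> \<open>The shear moves the delay from \<open>z\<close> to \<open>G\<close>. Now
    \<open>z\<close> is constant in \<open>s\<close>, and the inner integral is the one bounded by
    \<open>B\<close>.\<close>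
  also have "\<dots> = (\<integral>\<^sup>+ p. G (fst p - c * snd p) (snd p) * (z (fst p))\<^sup>2 \<partial>(lborel \<Otimes>\<^sub>M \<nu>))"
    by (subst nn_integral_shear[OF assms(1,2), where c = c, symmetric]) simp_all
  also have "\<dots> = (\<integral>\<^sup>+ u. \<integral>\<^sup>+ s. G (u - c * s) s * (z u)\<^sup>2 \<partial>\<nu> \<partial>lborel)"
    by (subst \<nu>.nn_integral_fst[symmetric]) simp_all
  also have "\<dots> = (\<integral>\<^sup>+ u. (\<integral>\<^sup>+ s. G (u - c * s) s \<partial>\<nu>) * (z u)\<^sup>2 \<partial>lborel)"
    by (intro nn_integral_cong nn_integral_multc) measurable
  also have "\<dots> \<le> (\<integral>\<^sup>+ u. B * (z u)\<^sup>2 \<partial>lborel)"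
    by (intro nn_integral_mono mult_right_mono B) simp
  also have "\<dots> = B * (\<integral>\<^sup>+ u. (z u)\<^sup>2 \<partial>lborel)"
    by (rule nn_integral_cmult) simp
  finally show ?thesis
    by (simp add: mult.assoc mult_left_mono)
qed

subsection \<open>Delay operators on the line\<close>

text \<open>The operator and its adjoint have the same shape: passing from one to the other replaces
  \<open>c\<close> by \<open>- c\<close> and \<open>h t s\<close> by the adjoint of \<open>h (t - c * s) s\<close>, and swaps the bounds.\<close>

locale delay_kernel = sigma_finite_measure \<nu> for \<nu> :: "real measure" +
  fixes h :: "real \<Rightarrow> real \<Rightarrow> 'e::{real_inner, banach, second_countable_topology} \<Rightarrow>\<^sub>L
                              'f::{real_inner, banach, second_countable_topology}"
    and c :: real and A B :: ennreal
  assumes ident_measurable [measurable]: "(\<lambda>s. s) \<in> borel_measurable \<nu>"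
    and weak_measurable [measurable]:
      "\<And>e f. (\<lambda>p. inner (blinfun_apply (h (fst p) (snd p)) e) f) \<in> borel_measurable (borel \<Otimes>\<^sub>M \<nu>)"
    and bound: "\<And>t. (\<integral>\<^sup>+ s. ennreal (norm (h t s)) \<partial>\<nu>) \<le> A"
    and dual_bound: "\<And>u. (\<integral>\<^sup>+ s. ennreal (norm (h (u - c * s) s)) \<partial>\<nu>) \<le> B"
    and finite_bounds: "A < \<infinity>" "B < \<infinity>"
begin

definition delay_integral :: "(real \<Rightarrow> 'e) \<Rightarrow> real \<Rightarrow> 'f"
  where "delay_integral z t = (\<integral>s. blinfun_apply (h t s) (z (t + c * s)) \<partial>\<nu>)"

lemma pair_sigma_finite_lborel: "pair_sigma_finite lborel \<nu>" ..

lemma apply_measurable: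
  assumes [measurable]: "z \<in> borel_measurable (borel \<Otimes>\<^sub>M \<nu>)"
  shows "(\<lambda>p. blinfun_apply (h (fst p) (snd p)) (z p)) \<in> borel_measurable (borel \<Otimes>\<^sub>M \<nu>)"
  by (rule borel_measurable_weak_blinfun_apply) measurable

lemma norm_measurable [measurable]:
  "(\<lambda>p. norm (h (fst p) (snd p))) \<in> borel_measurable (borel \<Otimes>\<^sub>M \<nu>)"
  by (rule borel_measurable_blinfun_norm) (rule apply_measurable, simp)

lemma delay_apply_measurable [measurable]:
  assumes [measurable]: "z \<in> borel_measurable borel"
  shows "(\<lambda>p. blinfun_apply (h (fst p) (snd p)) (z (fst p + c * snd p))) \<in> borel_measurable (borel \<Otimes>\<^sub>M \<nu>)"
  by (rule apply_measurable) measurable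

lemma delay_section_measurable [measurable]:
  assumes "z \<in> borel_measurable borel"
  shows "(\<lambda>s. blinfun_apply (h t s) (z (t + c * s))) \<in> borel_measurable \<nu>"
  using measurable_Pair2[OF delay_apply_measurable[OF assms], of t] by simp

lemma delay_kernel_adjoint:
  "delay_kernel \<nu> (\<lambda>t s. blinfun_adjoint (h (t - c * s) s)) (- c) B A"
proof unfold_locales
  show "(\<lambda>p. inner (blinfun_apply (blinfun_adjoint (h (fst p - c * snd p) (snd p))) e) f)
      \<in> borel_measurable (borel \<Otimes>\<^sub>M \<nu>)" for e f
  proof -
    have "(\<lambda>p. (fst p - c * snd p, snd p)) \<in> (borel \<Otimes>\<^sub>M \<nu>) \<rightarrow>\<^sub>M (borel \<Otimes>\<^sub>M \<nu>)"
      by measurable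
    from measurable_compose[OF this weak_measurable[of f e]]
    show ?thesis by (simp add: inner_blinfun_adjoint inner_commute[of e])
  qed
  show "(\<integral>\<^sup>+ s. ennreal (norm (blinfun_adjoint (h (t - c * s) s))) \<partial>\<nu>) \<le> B" for t
    by (rule order_trans[OF nn_integral_mono dual_bound[of t]])
      (intro ennreal_leI norm_blinfun_adjoint_le)
  \<comment> \<open>The two shifts cancel: \<open>u - (- c) * s - c * s\<close> equals
    \<open>u\<close>, so the dual bound of the adjoint kernel is the direct bound of
    \<open>h\<close>.\<close>
  show "(\<integral>\<^sup>+ s. ennreal (norm (blinfun_adjoint (h (u - (- c) * s - c * s) s))) \<partial>\<nu>) \<le> A" for u
    by (rule order_trans[OF nn_integral_mono bound[of u]])
      (simp add: ennreal_leI norm_blinfun_adjoint_le)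
qed (use finite_bounds in simp_all)

section \<open>Absolute estimates and their consequences for the delay integral\<close>

text \<open>The Schur test with weight \<open>norm (h t s)\<close>. Since the norm stands inside the
  inner integral, the bound serves existence of the Bochner integral, the \<open>L2\<close> estimate
  and Fubini alike.\<close>

lemma nn_integral_delay_bound:
  assumes [measurable]: "z \<in> borel_measurable borel"
  shows "(\<integral>\<^sup>+ t. (\<integral>\<^sup>+ s. ennreal (norm (blinfun_apply (h t s) (z (t + c * s)))) \<partial>\<nu>)\<^sup>2 \<partial>lborel)
    \<le> A * B * (\<integral>\<^sup>+ u. ennreal ((norm (z u))\<^sup>2) \<partial>lborel)"
proof -
  have "(\<integral>\<^sup>+ t. (\<integral>\<^sup>+ s. ennreal (norm (blinfun_apply (h t s) (z (t + c * s)))) \<partial>\<nu>)\<^sup>2 \<partial>lborel) \<le>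
      (\<integral>\<^sup>+ t. (\<integral>\<^sup>+ s. ennreal (norm (h t s)) * ennreal (norm (z (t + c * s))) \<partial>\<nu>)\<^sup>2 \<partial>lborel)"
    by (intro nn_integral_mono power_mono)
      (auto intro!: nn_integral_mono ennreal_leI norm_blinfun simp flip: ennreal_mult)
  also have "\<dots> \<le> A * B * (\<integral>\<^sup>+ u. (ennreal (norm (z u)))\<^sup>2 \<partial>lborel)"
    by (rule nn_integral_shear_kernel_bound[OF sigma_finite_measure_axioms])
      (use bound dual_bound norm_measurable in \<open>auto simp: split_beta'\<close>)
  finally show ?thesis by (simp add: ennreal_power)
qed

lemma nn_integral_delay_finite:
  assumes "z \<in> square_integrable lborel"
  shows "(\<integral>\<^sup>+ t. (\<integral>\<^sup>+ s. ennreal (norm (blinfun_apply (h t s) (z (t + c * s)))) \<partial>\<nu>)\<^sup>2 \<partial>lborel) < \<infinity>"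
proof -
  from assms have "z \<in> borel_measurable borel" and "integrable lborel (\<lambda>u. (norm (z u))\<^sup>2)"
    by (auto simp: square_integrable_def)
  then have "(\<integral>\<^sup>+ u. ennreal ((norm (z u))\<^sup>2) \<partial>lborel) < \<infinity>"
    by (simp add: integrable_iff_bounded)
  with finite_bounds have "A * B * (\<integral>\<^sup>+ u. ennreal ((norm (z u))\<^sup>2) \<partial>lborel) < \<infinity>"
    by (simp add: ennreal_mult_less_top)
  with nn_integral_delay_bound[OF \<open>z \<in> borel_measurable borel\<close>] show ?thesis
    by (rule le_less_trans)
qed

text \<open>A function of \<open>t\<close> with finite integral is finite almost everywhere; here
  that function is the square of the absolute inner integral.\<close>

lemma delay_integrable_AE:
  assumes "z \<in> square_integrable lborel"
  shows "AE t in lborel. integrable \<nu> (\<lambda>s. blinfun_apply (h t s) (z (t + c * s)))"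
proof -
  from assms have [measurable]: "z \<in> borel_measurable borel"
    by (auto simp: square_integrable_def)
  have "AE t in lborel. (\<integral>\<^sup>+ s. ennreal (norm (blinfun_apply (h t s) (z (t + c * s)))) \<partial>\<nu>)\<^sup>2 \<noteq> \<infinity>"
    using nn_integral_delay_finite[OF assms] by (intro nn_integral_noteq_infinite) simp_all
  then show ?thesis
    by eventually_elim (auto intro!: integrableI_bounded simp: less_top power_less_top_ennreal)
qed

lemma delay_integral_measurable [measurable]:
  assumes [measurable]: "z \<in> borel_measurable borel"
  shows "delay_integral z \<in> borel_measurable borel"
proof -
  have "(\<lambda>t. \<integral>s. blinfun_apply (h t s) (z (t + c * s)) \<partial>\<nu>) \<in> borel_measurable borel"
    by (rule borel_measurable_lebesgue_integral)
      (use delay_apply_measurable[OF assms] in \<open>simp add: split_beta'\<close>)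
  then show ?thesis by (simp add: delay_integral_def[abs_def])
qed

lemma norm_delay_integral_le:
  "ennreal (norm (delay_integral z t)) \<le> (\<integral>\<^sup>+ s. ennreal (norm (blinfun_apply (h t s) (z (t + c * s)))) \<partial>\<nu>)"
proof (cases "integrable \<nu> (\<lambda>s. blinfun_apply (h t s) (z (t + c * s)))")
  case True
  then show ?thesis unfolding delay_integral_def by (rule integral_norm_bound_ennreal)
next
  \<comment> \<open>A section that is not integrable has Bochner integral 0 by convention, so the
    bound holds at every \<open>t\<close> and not merely almost everywhere.\<close>
  case False
  then show ?thesis by (simp add: delay_integral_def not_integrable_integral_eq)
qed

lemma nn_integral_delay_integral_le:
  assumes "z \<in> borel_measurable borel"
  shows "(\<integral>\<^sup>+ t. ennreal ((norm (delay_integral z t))\<^sup>2) \<partial>lborel) \<le>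
    A * B * (\<integral>\<^sup>+ u. ennreal ((norm (z u))\<^sup>2) \<partial>lborel)"
proof -
  have "ennreal ((norm (delay_integral z t))\<^sup>2) \<le>
      (\<integral>\<^sup>+ s. ennreal (norm (blinfun_apply (h t s) (z (t + c * s)))) \<partial>\<nu>)\<^sup>2" for t
    using power_mono[OF norm_delay_integral_le[of z t], of 2] by (simp add: ennreal_power)
  then show ?thesis
    by (intro order_trans[OF nn_integral_mono nn_integral_delay_bound[OF assms]])
qed

lemma delay_integral_square_integrable:
  assumes "z \<in> square_integrable lborel"
  shows "delay_integral z \<in> square_integrable lborel"
proof -
  from assms have z: "z \<in> borel_measurable borel" "integrable lborel (\<lambda>u. (norm (z u))\<^sup>2)"
    by (auto simp: square_integrable_def)
  then have "(\<integral>\<^sup>+ u. ennreal ((norm (z u))\<^sup>2) \<partial>lborel) < \<infinity>"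
    by (simp add: integrable_iff_bounded)
  with finite_bounds have "A * B * (\<integral>\<^sup>+ u. ennreal ((norm (z u))\<^sup>2) \<partial>lborel) < \<infinity>"
    by (simp add: ennreal_mult_less_top)
  from le_less_trans[OF nn_integral_delay_integral_le[OF z(1)] this] delay_integral_measurable[OF z(1)]
  show ?thesis
    by (auto simp: square_integrable_def intro!: integrableI_bounded)
qed

text \<open>Fubini, then the shear, then Fubini back: the double integral of \<open>g\<close> is
  read once along the times of \<open>q\<close> and once along the times of
  \<open>z\<close>.\<close>

lemma delay_integral_adjoint:
  assumes "z \<in> square_integrable lborel" and "q \<in> square_integrable lborel"
  shows "(\<integral>t. inner (delay_integral z t) (q t) \<partial>lborel) =
    (\<integral>u. inner (z u) (delay_kernel.delay_integral \<nu> (\<lambda>t s. blinfun_adjoint (h (t - c * s) s)) (- c) q u) \<partial>lborel)"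
proof -
  interpret adj: delay_kernel \<nu> "\<lambda>t s. blinfun_adjoint (h (t - c * s) s)" "- c" B A
    by (rule delay_kernel_adjoint)
  interpret P: pair_sigma_finite lborel \<nu> by (rule pair_sigma_finite_lborel)
  from assms have [measurable]: "z \<in> borel_measurable borel" "q \<in> borel_measurable borel"
    and q: "integrable lborel (\<lambda>t. (norm (q t))\<^sup>2)"
    by (auto simp: square_integrable_def)
  define g where "g p = inner (blinfun_apply (h (fst p) (snd p)) (z (fst p + c * snd p))) (q (fst p))" for p
  have [measurable]: "g \<in> borel_measurable (borel \<Otimes>\<^sub>M \<nu>)"
    unfolding g_def by measurable
  define N where "N t = (\<integral>\<^sup>+ s. ennreal (norm (blinfun_apply (h t s) (z (t + c * s)))) \<partial>\<nu>)" for t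
  have [measurable]: "N \<in> borel_measurable borel"
    unfolding N_def using delay_apply_measurable[of z]
    by (intro borel_measurable_nn_integral) (simp add: split_beta')
  have "(\<integral>\<^sup>+ p. ennreal (norm (g p)) \<partial>(lborel \<Otimes>\<^sub>M \<nu>)) = (\<integral>\<^sup>+ t. \<integral>\<^sup>+ s. ennreal (norm (g (t, s))) \<partial>\<nu> \<partial>lborel)"
    by (subst nn_integral_fst[symmetric]) simp_all
  also have "\<dots> \<le> (\<integral>\<^sup>+ t. \<integral>\<^sup>+ s. ennreal (norm (blinfun_apply (h t s) (z (t + c * s)))) * ennreal (norm (q t)) \<partial>\<nu> \<partial>lborel)"
    by (intro nn_integral_mono) (simp add: g_def Cauchy_Schwarz_ineq2 flip: ennreal_mult)
  also have "\<dots> = (\<integral>\<^sup>+ t. N t * ennreal (norm (q t)) \<partial>lborel)"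
    unfolding N_def
    by (intro nn_integral_cong nn_integral_multc) simp
  finally have le: "(\<integral>\<^sup>+ p. ennreal (norm (g p)) \<partial>(lborel \<Otimes>\<^sub>M \<nu>)) \<le> (\<integral>\<^sup>+ t. N t * ennreal (norm (q t)) \<partial>lborel)" .
  \<comment> \<open>Both \<open>N\<close> and \<open>norm (q t)\<close> have finite square integral,
    so Cauchy-Schwarz in \<open>t\<close> gives the absolute integrability of \<open>g\<close> that
    Fubini requires.\<close>
  have "(\<integral>\<^sup>+ t. N t * ennreal (norm (q t)) \<partial>lborel)\<^sup>2 \<le> (\<integral>\<^sup>+ t. (N t)\<^sup>2 \<partial>lborel) * (\<integral>\<^sup>+ t. (ennreal (norm (q t)))\<^sup>2 \<partial>lborel)"
    by (rule Cauchy_Schwarz_nn_integral) simp_all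
  also have "\<dots> < \<infinity>"
    using nn_integral_delay_finite[OF assms(1)] q
    by (simp add: N_def ennreal_mult_less_top ennreal_power integrable_iff_bounded)
  finally have "(\<integral>\<^sup>+ t. N t * ennreal (norm (q t)) \<partial>lborel) < \<infinity>"
    by (simp add: power_less_top_ennreal)
  with le have g: "integrable (lborel \<Otimes>\<^sub>M \<nu>) g"
    by (intro integrableI_bounded) (simp_all add: le_less_trans)
  let ?S = "\<lambda>p::real \<times> real. (fst p - c * snd p, snd p)"
  have S: "?S \<in> (lborel \<Otimes>\<^sub>M \<nu>) \<rightarrow>\<^sub>M (lborel \<Otimes>\<^sub>M \<nu>)"
    by measurable
  note distr = distr_shear[OF sigma_finite_measure_axioms ident_measurable, of c]
  have gS: "integrable (lborel \<Otimes>\<^sub>M \<nu>) (\<lambda>p. g (?S p))"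
    using integrable_distr[OF S, of g] g by (simp add: distr)
  have "(\<integral>t. inner (delay_integral z t) (q t) \<partial>lborel) = (\<integral>t. (\<integral>s. g (t, s) \<partial>\<nu>) \<partial>lborel)"
  proof (rule integral_cong_AE)
    show "(\<lambda>t. \<integral>s. g (t, s) \<partial>\<nu>) \<in> borel_measurable lborel"
      by (rule borel_measurable_lebesgue_integral) simp
    \<comment> \<open>The inner product passes through the inner integral wherever the section is
      integrable, which is almost everywhere.\<close>
    show "AE t in lborel. inner (delay_integral z t) (q t) = (\<integral>s. g (t, s) \<partial>\<nu>)"
      using delay_integrable_AE[OF assms(1)]
      by eventually_elim (simp add: delay_integral_def g_def)
  qed simp
  also have "\<dots> = (\<integral>p. g p \<partial>(lborel \<Otimes>\<^sub>M \<nu>))"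
    by (rule P.integral_fst'[OF g])
  \<comment> \<open>After the shear \<open>z\<close> is evaluated at \<open>u\<close> alone, while
    the kernel and \<open>q\<close> are evaluated at \<open>u - c * s\<close>.\<close>
  also have "\<dots> = (\<integral>p. g (?S p) \<partial>(lborel \<Otimes>\<^sub>M \<nu>))"
    using integral_distr[OF S, of g] by (simp add: distr)
  also have "\<dots> = (\<integral>u. (\<integral>s. g (?S (u, s)) \<partial>\<nu>) \<partial>lborel)"
    by (rule P.integral_fst'[OF gS, symmetric])
  also have "\<dots> = (\<integral>u. inner (z u) (adj.delay_integral q u) \<partial>lborel)"
  proof (rule integral_cong_AE)
    show "(\<lambda>u. \<integral>s. g (?S (u, s)) \<partial>\<nu>) \<in> borel_measurable lborel"
      by (rule borel_measurable_lebesgue_integral) simp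
    show "AE u in lborel. (\<integral>s. g (?S (u, s)) \<partial>\<nu>) = inner (z u) (adj.delay_integral q u)"
      using adj.delay_integrable_AE[OF assms(2)]
      by eventually_elim
        (simp add: adj.delay_integral_def g_def inner_blinfun_adjoint inner_commute[of "z _"]
          flip: integral_inner_left, simp add: inner_commute)
  qed simp
  finally show ?thesis .
qed

end

subsection \<open>Square integrable functions on subspaces\<close>

lemma square_integrable_cong:
  assumes "\<And>x. x \<in> space M \<Longrightarrow> f x = g x"
  shows "f \<in> square_integrable M \<longleftrightarrow> g \<in> square_integrable M"
proof -
  have "f \<in> borel_measurable M \<longleftrightarrow> g \<in> borel_measurable M"
    by (rule measurable_cong) (rule assms)
  moreover have "integrable M (\<lambda>x. (norm (f x))\<^sup>2) \<longleftrightarrow> integrable M (\<lambda>x. (norm (g x))\<^sup>2)"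
    by (rule Bochner_Integration.integrable_cong) (simp_all add: assms)
  ultimately show ?thesis by (simp add: square_integrable_def)
qed

text \<open>Extension by zero is the bridge from the intervals to the line, where a delay is a plain
  translation.\<close>

lemma square_integrable_restrict_space:
  assumes "S \<in> sets M"
  shows "f \<in> square_integrable (restrict_space M S) \<longleftrightarrow>
    (\<lambda>x. indicat_real S x *\<^sub>R f x) \<in> square_integrable M"
proof -
  have S: "S \<inter> space M \<in> sets M" using assms by simp
  have eq: "(norm (indicat_real S x *\<^sub>R f x))\<^sup>2 = indicat_real S x *\<^sub>R (norm (f x))\<^sup>2" for x
    by (simp add: indicator_def)
  show ?thesis
    by (simp only: square_integrable_def mem_Collect_eq borel_measurable_restrict_space_iff[OF S]
        integrable_restrict_space[OF S] eq)
qed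

lemma square_integrable_restrict_spaceI:
  assumes "S \<in> sets M" and "f \<in> square_integrable M"
  shows "f \<in> square_integrable (restrict_space M S)"
proof -
  from assms(2) have "f \<in> borel_measurable M" and "integrable M (\<lambda>x. (norm (f x))\<^sup>2)"
    by (auto simp: square_integrable_def)
  moreover from this(2) have "integrable M (\<lambda>x. indicat_real S x *\<^sub>R (norm (f x))\<^sup>2)"
    using assms(1) by (intro integrable_mult_indicator)
  ultimately show ?thesis
    using assms(1) by (simp add: square_integrable_def integrable_restrict_space measurable_restrict_space1)
qed

lemma square_integrable_diff:
  assumes "f \<in> square_integrable M" "g \<in> square_integrable M"
  shows "(\<lambda>x. f x - g x) \<in> square_integrable M"
proof -
  from assms have [measurable]: "f \<in> borel_measurable M" "g \<in> borel_measurable M"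
    and int: "integrable M (\<lambda>x. (norm (f x))\<^sup>2)" "integrable M (\<lambda>x. (norm (g x))\<^sup>2)"
    by (auto simp: square_integrable_def)
  have le: "(norm (f x - g x))\<^sup>2 \<le> 2 * (norm (f x))\<^sup>2 + 2 * (norm (g x))\<^sup>2" for x
  proof -
    \<comment> \<open>By the parallelogram law this square is exactly the gap between the two
      sides.\<close>
    have "0 \<le> (norm (f x + g x))\<^sup>2" by simp
    then show ?thesis
      unfolding power2_norm_eq_inner by (simp add: inner_simps inner_commute)
  qed
  have "integrable M (\<lambda>x. 2 * (norm (f x))\<^sup>2 + 2 * (norm (g x))\<^sup>2)"
    using int by simp
  then have "integrable M (\<lambda>x. (norm (f x - g x))\<^sup>2)"
    by (rule Bochner_Integration.integrable_bound) (use le in auto)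
  then show ?thesis by (simp add: square_integrable_def)
qed

lemma integrable_inner_square_integrable:
  assumes "f \<in> square_integrable M" "g \<in> square_integrable M"
  shows "integrable M (\<lambda>x. inner (f x) (g x))"
proof -
  from assms have [measurable]: "f \<in> borel_measurable M" "g \<in> borel_measurable M"
    and int: "integrable M (\<lambda>x. (norm (f x))\<^sup>2)" "integrable M (\<lambda>x. (norm (g x))\<^sup>2)"
    by (auto simp: square_integrable_def)
  have le: "\<bar>inner (f x) (g x)\<bar> \<le> (norm (f x))\<^sup>2 + (norm (g x))\<^sup>2" for x
  proof -
    have "norm (f x) * norm (g x) \<le> (norm (f x))\<^sup>2 + (norm (g x))\<^sup>2"
      using sum_squares_bound[of "norm (f x)" "norm (g x)"]
        mult_nonneg_nonneg[OF norm_ge_zero norm_ge_zero, of "f x" "g x"]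
      unfolding mult.assoc by linarith
    with Cauchy_Schwarz_ineq2[of "f x" "g x"] show ?thesis by linarith
  qed
  have "integrable M (\<lambda>x. (norm (f x))\<^sup>2 + (norm (g x))\<^sup>2)"
    using int by simp
  then show ?thesis
    by (rule Bochner_Integration.integrable_bound) (use le in auto)
qed

text \<open>Test both adjoint identities against the difference \<open>S Q - S' Q\<close>. This lets
  an arbitrary adjoint be compared with an explicit one.\<close>

lemma is_L2_adjoint_unique:
  assumes "is_L2_adjoint M N R S" and "is_L2_adjoint M N R S'" and Q: "Q \<in> square_integrable N"
  shows "AE x in M. S Q x = S' Q x"
proof -
  have SQ: "S Q \<in> square_integrable M" "S' Q \<in> square_integrable M"
    using assms by (auto simp: is_L2_adjoint_def)
  define Z where "Z x = S Q x - S' Q x" for x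
  have Z: "Z \<in> square_integrable M"
    unfolding Z_def[abs_def] by (rule square_integrable_diff[OF SQ])
  have "(\<integral>x. inner (Z x) (S Q x) \<partial>M) = (\<integral>x. inner (Z x) (S' Q x) \<partial>M)"
    using assms Z unfolding is_L2_adjoint_def by metis
  then have "(\<integral>x. inner (Z x) (S Q x) - inner (Z x) (S' Q x) \<partial>M) = 0"
    using integrable_inner_square_integrable[OF Z SQ(1)] integrable_inner_square_integrable[OF Z SQ(2)]
    by simp
  then have "(\<integral>x. (norm (Z x))\<^sup>2 \<partial>M) = 0"
    by (simp add: power2_norm_eq_inner Z_def inner_diff_right)
  then have "AE x in M. (norm (Z x))\<^sup>2 = 0"
    using Z by (subst (asm) integral_nonneg_eq_0_iff_AE) (auto simp: square_integrable_def)
  then show ?thesis by eventually_elim (simp add: Z_def)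
qed

lemma L2_norm_eq_nn_integral:
  assumes "f \<in> borel_measurable M"
  shows "L2_norm M f = sqrt (enn2real (\<integral>\<^sup>+ x. ennreal ((norm (f x))\<^sup>2) \<partial>M))"
  unfolding L2_norm_def using assms by (subst integral_eq_nn_integral) simp_all

subsection \<open>Reduction to the line\<close>

text \<open>Cutting the kernel off outside its rectangle turns the suprema over
  \<open>{0..T}\<close> and \<open>{-K..T}\<close> into bounds at every real time, as the locale
  demands.\<close>

lemma delay_kernel_of_weakly_measurable_on:
  fixes k :: "real \<Rightarrow> real \<Rightarrow> 'e::{real_inner, banach, second_countable_topology} \<Rightarrow>\<^sub>L
                              'f::{real_inner, banach, second_countable_topology}"
  assumes "finite_measure \<nu>" and sets: "sets \<nu> = sets (restrict_space borel {-K..0})"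
    and weak: "weakly_measurable_on ({0..T} \<times> {-K..0}) k"
    and M0: "M\<^sub>0 = (SUP t\<in>{0..T}. \<integral>\<^sup>+ s. ennreal (norm (k t s)) \<partial>\<nu>)" and "M\<^sub>0 < \<infinity>"
    and M: "M = (SUP t\<in>{-K..T}. \<integral>\<^sup>+ s. ennreal (norm (k (t - s) s)) * indicator {t-T..t} s \<partial>\<nu>)"
    and "M < \<infinity>"
  shows "delay_kernel \<nu> (\<lambda>t s. if t \<in> {0..T} \<and> s \<in> {-K..0} then k t s else 0) 1 M\<^sub>0 M"
proof -
  interpret finite_measure \<nu> by fact
  let ?D = "{0..T} \<times> {-K..0}"
  let ?h = "\<lambda>t s. if t \<in> {0..T} \<and> s \<in> {-K..0} then k t s else 0"
  have space: "space \<nu> = {-K..0}"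
    using sets_eq_imp_space_eq[OF sets] by (simp add: space_restrict_space)
  have ident [measurable]: "(\<lambda>s. s) \<in> borel_measurable \<nu>"
    unfolding measurable_cong_sets[OF sets refl] by (intro measurable_restrict_space1) simp
  show ?thesis
  proof unfold_locales
    show "(\<lambda>p. inner (blinfun_apply (?h (fst p) (snd p)) e) f) \<in> borel_measurable (borel \<Otimes>\<^sub>M \<nu>)" for e f
    proof -
      have "?D \<inter> space borel \<in> sets borel"
        by (auto intro!: borel_closed closed_Times)
      with weak have k: "(\<lambda>p. indicat_real ?D p *\<^sub>R (case p of (t, s) \<Rightarrow> inner (blinfun_apply (k t s) e) f))
          \<in> borel_measurable borel"
        unfolding weakly_measurable_on_def by (simp only: borel_measurable_restrict_space_iff)
      \<comment> \<open>\<open>\<nu>\<close> carries the trace of the Borel sets on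
        \<open>{-K..0}\<close>; the inclusion into the Borel plane is measurable, so measurability
        of the cut-off kernel pulls back.\<close>
      have "(\<lambda>p :: real \<times> real. (fst p, snd p)) \<in> borel \<Otimes>\<^sub>M \<nu> \<rightarrow>\<^sub>M borel"
        by measurable
      from measurable_compose[OF this k] show ?thesis
        by (rule measurable_cong[THEN iffD1, rotated]) (auto simp: indicator_def split_beta mem_Times_iff)
    qed
    show "(\<integral>\<^sup>+ s. ennreal (norm (?h t s)) \<partial>\<nu>) \<le> M\<^sub>0" for t
    proof (cases "t \<in> {0..T}")
      case True
      then have "(\<integral>\<^sup>+ s. ennreal (norm (?h t s)) \<partial>\<nu>) = (\<integral>\<^sup>+ s. ennreal (norm (k t s)) \<partial>\<nu>)"
        by (intro nn_integral_cong) (simp add: space)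
      also have "\<dots> \<le> M\<^sub>0"
        unfolding M0 using True by (rule SUP_upper)
      finally show ?thesis .
    next
      case False
      then have zero: "?h t s = 0" for s by auto
      show ?thesis by (simp only: zero norm_zero) simp
    qed
    show "(\<integral>\<^sup>+ s. ennreal (norm (?h (u - 1 * s) s)) \<partial>\<nu>) \<le> M" for u
    proof (cases "u \<in> {-K..T}")
      case True
      \<comment> \<open>The cut-off \<open>u - s \<in> {0..T}\<close> is the condition
        \<open>s \<in> {u-T..u}\<close>.\<close>
      then have "(\<integral>\<^sup>+ s. ennreal (norm (?h (u - 1 * s) s)) \<partial>\<nu>) =
          (\<integral>\<^sup>+ s. ennreal (norm (k (u - s) s)) * indicator {u-T..u} s \<partial>\<nu>)"
        by (intro nn_integral_cong) (auto simp: space indicator_def)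
      also have "\<dots> \<le> M"
        unfolding M using True by (rule SUP_upper)
      finally show ?thesis .
    next
      case False
      \<comment> \<open>If the kernel were nonzero, \<open>u\<close> would be the sum of
        \<open>u - s \<in> {0..T}\<close> and \<open>s \<in> {-K..0}\<close>, hence in
        \<open>{-K..T}\<close>.\<close>
      then have zero: "?h (u - 1 * s) s = 0" for s by auto
      show ?thesis by (simp only: zero norm_zero) simp
    qed
  qed (use assms in simp_all)
qed

text \<open>Elements of \<open>L2\<close> have representatives only up to null sets, so the formula
  is claimed for every \<open>\<rho>'\<close> satisfying the adjoint identity; the existence clause
  keeps this from being vacuous. The integrability clauses exclude the default value 0 of the
  Bochner integral.\<close>

theorem proposition4p2:
  fixes T K :: real
    and \<nu>\<^sub>0 :: "real measure"
    and k :: "real \<Rightarrow> real \<Rightarrow> 'e::{real_inner, banach, second_countable_topology} \<Rightarrow>\<^sub>L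
                              'f::{real_inner, banach, second_countable_topology}"
    and M M\<^sub>0 :: ennreal
  assumes "T > 0" and "K \<ge> 0"
    and "finite_measure \<nu>\<^sub>0" and "sets \<nu>\<^sub>0 = sets (restrict_space borel {-K..0})"
    and "weakly_measurable_on ({0..T} \<times> {-K..0}) k"
    and "M\<^sub>0 = (SUP t\<in>{0..T}. \<integral>\<^sup>+ s. ennreal (norm (k t s)) \<partial>\<nu>\<^sub>0)" and "M\<^sub>0 < \<infinity>"
    and "M = (SUP t\<in>{-K..T}. \<integral>\<^sup>+ s. ennreal (norm (k (t - s) s)) * indicator {t-T..t} s \<partial>\<nu>\<^sub>0)"
    and "M < \<infinity>"
  shows "(\<forall>Z :: real \<Rightarrow> 'e. Z \<in> square_integrable (interval_measure_on (-K) T) \<longrightarrow>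
           (AE t in interval_measure_on 0 T. integrable \<nu>\<^sub>0 (\<lambda>s. blinfun_apply (k t s) (Z (t + s))))) \<and>
         L2_bounded_linear (interval_measure_on (-K) T) (interval_measure_on 0 T) (delay_operator \<nu>\<^sub>0 k) \<and>
         (\<exists>\<rho>'. is_L2_adjoint (interval_measure_on (-K) T) (interval_measure_on 0 T) (delay_operator \<nu>\<^sub>0 k) \<rho>') \<and>
         (\<forall>\<rho>'. is_L2_adjoint (interval_measure_on (-K) T) (interval_measure_on 0 T) (delay_operator \<nu>\<^sub>0 k) \<rho>' \<longrightarrow>
           (\<forall>Q \<in> square_integrable (interval_measure_on 0 T).
             (AE t in interval_measure_on (-K) T.
               integrable \<nu>\<^sub>0 (\<lambda>s. indicat_real {t-T..t} s *\<^sub>R adjoint (blinfun_apply (k (t - s) s)) (Q (t - s))) \<and>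
               \<rho>' Q t = (\<integral>s. indicat_real {t-T..t} s *\<^sub>R adjoint (blinfun_apply (k (t - s) s)) (Q (t - s)) \<partial>\<nu>\<^sub>0)) \<and>
             (\<forall>K' \<in> {-K..T}.
               (\<integral>\<^sup>+ t\<in>{K'..T}. ennreal ((norm (\<rho>' Q t))\<^sup>2) \<partial>lborel)
                 \<le> M * M\<^sub>0 * (\<integral>\<^sup>+ u\<in>{max 0 K'..T}. ennreal ((norm (Q u))\<^sup>2) \<partial>lborel))))"
proof -
  interpret finite_measure \<nu>\<^sub>0 by fact
  define h where "h t s = (if t \<in> {0..T} \<and> s \<in> {-K..0} then k t s else 0)" for t s
  interpret h: delay_kernel \<nu>\<^sub>0 h 1 M\<^sub>0 M
    unfolding h_def[abs_def] by (rule delay_kernel_of_weakly_measurable_on) fact+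
  interpret adj: delay_kernel \<nu>\<^sub>0 "\<lambda>t s. blinfun_adjoint (h (t - 1 * s) s)" "- 1" M M\<^sub>0
    by (rule h.delay_kernel_adjoint)
  have space: "space \<nu>\<^sub>0 = {-K..0}"
    using sets_eq_imp_space_eq[OF assms(4)] by (simp add: space_restrict_space)
  let ?I = "interval_measure_on (-K) T" and ?J = "interval_measure_on 0 T"
  let ?eI = "\<lambda>Z :: real \<Rightarrow> 'e. \<lambda>t. indicat_real {-K..T} t *\<^sub>R Z t"
  let ?eJ = "\<lambda>Q :: real \<Rightarrow> 'f. \<lambda>t. indicat_real {0..T} t *\<^sub>R Q t"
  let ?R = "delay_operator \<nu>\<^sub>0 k"
  let ?a = "\<lambda>(Q :: real \<Rightarrow> 'f) t s.
    indicat_real {t-T..t} s *\<^sub>R adjoint (blinfun_apply (k (t - s) s)) (Q (t - s))"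
  define S where "S Q t = (\<integral>s. ?a Q t s \<partial>\<nu>\<^sub>0)" for Q t
  have eI: "Z \<in> square_integrable ?I \<longleftrightarrow> ?eI Z \<in> square_integrable lborel" for Z
    by (rule square_integrable_restrict_space) simp
  have eJ: "Q \<in> square_integrable ?J \<longleftrightarrow> ?eJ Q \<in> square_integrable lborel" for Q
    by (rule square_integrable_restrict_space) simp
  have AE_I: "(AE t in ?I. P t) \<longleftrightarrow> (AE t in lborel. t \<in> {-K..T} \<longrightarrow> P t)" for P
    by (rule AE_restrict_space_iff) simp
  have AE_J: "(AE t in ?J. P t) \<longleftrightarrow> (AE t in lborel. t \<in> {0..T} \<longrightarrow> P t)" for P
    by (rule AE_restrict_space_iff) simp
  \<comment> \<open>For these \<open>t\<close> and \<open>s\<close> the time \<open>t + s\<close>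
    lies in \<open>{-K..T}\<close>, so neither cut-off changes the value. The factor
    \<open>1 *\<close> is the locale parameter \<open>c\<close>, kept so that rewriting
    matches.\<close>
  have h_apply: "blinfun_apply (h t s) (?eI Z (t + 1 * s)) = blinfun_apply (k t s) (Z (t + s))"
    if "t \<in> {0..T}" "s \<in> space \<nu>\<^sub>0" for Z t s
    using that by (simp add: h_def space)
  \<comment> \<open>The cut-offs enforce \<open>t - s \<in> {0..T}\<close>, which is what the
    indicator of \<open>{t-T..t}\<close> says; otherwise both sides are 0.\<close>
  have adj_apply: "blinfun_apply (blinfun_adjoint (h (t - 1 * s) s)) (?eJ Q (t + - 1 * s)) = ?a Q t s"
    if "t \<in> {-K..T}" "s \<in> space \<nu>\<^sub>0" for Q t s
  proof (cases "t - s \<in> {0..T}")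
    case True
    with that show ?thesis by (simp add: h_def space blinfun_apply_adjoint)
  next
    case False
    then have "indicat_real {0..T} (t + - 1 * s) = 0" "indicat_real {t-T..t} s = 0"
      by (auto simp: indicator_def)
    then show ?thesis by (simp only: scaleR_zero_left blinfun.zero_right)
  qed
  have R_eq: "?R Z t = h.delay_integral (?eI Z) t" if "t \<in> {0..T}" for Z t
    unfolding delay_operator_def h.delay_integral_def
    by (rule Bochner_Integration.integral_cong) (simp_all only: h_apply[OF that])
  have S_eq: "S Q t = adj.delay_integral (?eJ Q) t" if "t \<in> {-K..T}" for Q t
    unfolding S_def adj.delay_integral_def
    by (rule Bochner_Integration.integral_cong) (simp_all only: adj_apply[OF that])
  have R_int: "AE t in ?J. integrable \<nu>\<^sub>0 (\<lambda>s. blinfun_apply (k t s) (Z (t + s)))"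
    if "Z \<in> square_integrable ?I" for Z
    unfolding AE_J using h.delay_integrable_AE[OF that[unfolded eI]]
  proof eventually_elim
    case (elim t)
    show ?case
    proof
      assume t: "t \<in> {0..T}"
      show "integrable \<nu>\<^sub>0 (\<lambda>s. blinfun_apply (k t s) (Z (t + s)))"
        using elim by (rule Bochner_Integration.integrable_cong[THEN iffD1, rotated 2])
          (simp_all only: h_apply[OF t])
    qed
  qed
  have S_int: "AE t in ?I. integrable \<nu>\<^sub>0 (?a Q t)" if "Q \<in> square_integrable ?J" for Q
    unfolding AE_I using adj.delay_integrable_AE[OF that[unfolded eJ]]
  proof eventually_elim
    case (elim t)
    show ?case
    proof
      assume t: "t \<in> {-K..T}"
      show "integrable \<nu>\<^sub>0 (?a Q t)"
        using elim by (rule Bochner_Integration.integrable_cong[THEN iffD1, rotated 2])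
          (simp_all only: adj_apply[OF t])
    qed
  qed
  have R_sq: "?R Z \<in> square_integrable ?J" if "Z \<in> square_integrable ?I" for Z
  proof -
    have "h.delay_integral (?eI Z) \<in> square_integrable ?J"
      using that unfolding eI
      by (intro square_integrable_restrict_spaceI h.delay_integral_square_integrable) simp_all
    then show ?thesis
      by (rule square_integrable_cong[THEN iffD1, rotated]) (simp add: R_eq)
  qed
  have S_sq: "S Q \<in> square_integrable ?I" if "Q \<in> square_integrable ?J" for Q
  proof -
    have "adj.delay_integral (?eJ Q) \<in> square_integrable ?I"
      using that unfolding eJ
      by (intro square_integrable_restrict_spaceI adj.delay_integral_square_integrable) simp_all
    then show ?thesis
      by (rule square_integrable_cong[THEN iffD1, rotated]) (simp add: S_eq)
  qed
  have lin: "L2_bounded_linear ?I ?J ?R"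
    unfolding L2_bounded_linear_def
  proof (intro conjI ballI allI)
    fix Y Z :: "real \<Rightarrow> 'e" and c d :: real
    assume "Y \<in> square_integrable ?I" "Z \<in> square_integrable ?I"
    \<comment> \<open>Additivity of the Bochner integral is available at those \<open>t\<close>
      where both sections are integrable.\<close>
    from R_int[OF this(1)] R_int[OF this(2)]
    show "AE t in ?J. ?R (\<lambda>x. c *\<^sub>R Y x + d *\<^sub>R Z x) t = c *\<^sub>R ?R Y t + d *\<^sub>R ?R Z t"
      by eventually_elim (simp add: delay_operator_def blinfun.add_right blinfun.scaleR_right)
  next
    show "\<exists>C. \<forall>Z\<in>square_integrable ?I. L2_norm ?J (?R Z) \<le> C * L2_norm ?I Z"
    proof (intro exI ballI)
      fix Z :: "real \<Rightarrow> 'e" assume Z: "Z \<in> square_integrable ?I"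
      let ?b = "\<integral>\<^sup>+ x. ennreal ((norm (Z x))\<^sup>2) \<partial>?I"
      have meas: "?R Z \<in> borel_measurable ?J" "Z \<in> borel_measurable ?I"
        "?eI Z \<in> borel_measurable borel"
        using R_sq[OF Z] Z Z[unfolded eI] by (auto simp: square_integrable_def)
      have "(\<integral>\<^sup>+ t. ennreal ((norm (?R Z t))\<^sup>2) \<partial>?J) =
          (\<integral>\<^sup>+ t. ennreal ((norm (h.delay_integral (?eI Z) t))\<^sup>2) * indicator {0..T} t \<partial>lborel)"
        by (subst nn_integral_restrict_space)
          (auto intro!: nn_integral_cong simp: R_eq indicator_def)
      also have "\<dots> \<le> (\<integral>\<^sup>+ t. ennreal ((norm (h.delay_integral (?eI Z) t))\<^sup>2) \<partial>lborel)"
        by (intro nn_integral_mono) (auto simp: indicator_def)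
      also have "\<dots> \<le> M\<^sub>0 * M * (\<integral>\<^sup>+ u. ennreal ((norm (?eI Z u))\<^sup>2) \<partial>lborel)"
        by (rule h.nn_integral_delay_integral_le[OF meas(3)])
      also have "(\<integral>\<^sup>+ u. ennreal ((norm (?eI Z u))\<^sup>2) \<partial>lborel) = ?b"
        by (subst nn_integral_restrict_space) (auto intro!: nn_integral_cong simp: indicator_def)
      finally have le: "(\<integral>\<^sup>+ t. ennreal ((norm (?R Z t))\<^sup>2) \<partial>?J) \<le> M\<^sub>0 * M * ?b" .
      have "?b < \<infinity>"
        using Z by (simp add: square_integrable_def integrable_iff_bounded)
      then have "M\<^sub>0 * M * ?b < top"
        using h.finite_bounds by (simp add: ennreal_mult_less_top)
      from enn2real_mono[OF le this]
      show "L2_norm ?J (?R Z) \<le> sqrt (enn2real (M\<^sub>0 * M)) * L2_norm ?I Z"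
        using meas(1,2) by (simp add: L2_norm_eq_nn_integral enn2real_mult flip: real_sqrt_mult)
    qed
  qed (rule R_sq)
  have adjoint: "is_L2_adjoint ?I ?J ?R S"
    unfolding is_L2_adjoint_def
  proof (intro conjI ballI)
    fix Z :: "real \<Rightarrow> 'e" and Q :: "real \<Rightarrow> 'f"
    assume Z: "Z \<in> square_integrable ?I" and Q: "Q \<in> square_integrable ?J"
    \<comment> \<open>The indicator restricting the measure to \<open>{0..T}\<close> is absorbed
      into the zero extension of \<open>Q\<close>; after duality on the line, the indicator in
      \<open>?eI Z\<close> restores the measure on \<open>{-K..T}\<close>.\<close>
    have "(\<integral>t. inner (?R Z t) (Q t) \<partial>?J) = (\<integral>t. inner (h.delay_integral (?eI Z) t) (?eJ Q t) \<partial>lborel)"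
      by (subst integral_restrict_space)
        (auto intro!: Bochner_Integration.integral_cong simp: R_eq indicator_def)
    also have "\<dots> = (\<integral>t. inner (?eI Z t) (adj.delay_integral (?eJ Q) t) \<partial>lborel)"
      by (rule h.delay_integral_adjoint[OF Z[unfolded eI] Q[unfolded eJ]])
    also have "\<dots> = (\<integral>t. inner (Z t) (S Q t) \<partial>?I)"
      by (subst integral_restrict_space)
        (auto intro!: Bochner_Integration.integral_cong simp: S_eq indicator_def)
    finally show "(\<integral>t. inner (?R Z t) (Q t) \<partial>?J) = (\<integral>t. inner (Z t) (S Q t) \<partial>?I)" .
  qed (rule S_sq)
  have S_bound: "(\<integral>\<^sup>+ t\<in>{K'..T}. ennreal ((norm (S Q t))\<^sup>2) \<partial>lborel)
      \<le> M * M\<^sub>0 * (\<integral>\<^sup>+ u\<in>{max 0 K'..T}. ennreal ((norm (Q u))\<^sup>2) \<partial>lborel)"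
    if Q: "Q \<in> square_integrable ?J" and K': "K' \<in> {-K..T}" for Q K'
  proof -
    \<comment> \<open>Truncating \<open>Q\<close> before applying the estimate on the line is what
      localises the right-hand side to \<open>{max 0 K'..T}\<close>.\<close>
    define q where "q u = indicat_real {max 0 K'..T} u *\<^sub>R Q u" for u
    have [measurable]: "?eJ Q \<in> borel_measurable borel"
      using Q[unfolded eJ] by (simp add: square_integrable_def)
    have "(\<lambda>u. indicat_real {max 0 K'..T} u *\<^sub>R ?eJ Q u) \<in> borel_measurable borel"
      by measurable
    also have "(\<lambda>u. indicat_real {max 0 K'..T} u *\<^sub>R ?eJ Q u) = q"
      by (auto simp: q_def indicator_def)
    finally have q: "q \<in> borel_measurable borel" .
    \<comment> \<open>Since \<open>s \<le> 0\<close>, for \<open>t \<ge> K'\<close> only the values of \<open>Q\<close> at times \<open>t - s \<ge> K'\<close> enter.\<close>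
    have S_q: "S Q t = adj.delay_integral q t" if "t \<in> {K'..T}" for t
    proof -
      have "S Q t = adj.delay_integral (?eJ Q) t"
        using that K' by (intro S_eq) simp
      also have "\<dots> = adj.delay_integral q t"
        unfolding adj.delay_integral_def using that
        by (intro Bochner_Integration.integral_cong) (simp_all add: q_def space indicator_def)
      finally show ?thesis .
    qed
    have "(\<integral>\<^sup>+ t\<in>{K'..T}. ennreal ((norm (S Q t))\<^sup>2) \<partial>lborel) \<le>
        (\<integral>\<^sup>+ t. ennreal ((norm (adj.delay_integral q t))\<^sup>2) \<partial>lborel)"
      by (intro nn_integral_mono) (auto simp: indicator_def S_q)
    also have "\<dots> \<le> M * M\<^sub>0 * (\<integral>\<^sup>+ u. ennreal ((norm (q u))\<^sup>2) \<partial>lborel)"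
      by (rule adj.nn_integral_delay_integral_le[OF q])
    also have "(\<integral>\<^sup>+ u. ennreal ((norm (q u))\<^sup>2) \<partial>lborel) =
        (\<integral>\<^sup>+ u\<in>{max 0 K'..T}. ennreal ((norm (Q u))\<^sup>2) \<partial>lborel)"
      by (intro nn_integral_cong) (auto simp: q_def indicator_def)
    finally show ?thesis .
  qed
  show ?thesis
  proof (intro conjI allI impI ballI)
    show "\<exists>\<rho>'. is_L2_adjoint ?I ?J ?R \<rho>'"
      using adjoint by blast
  next
    fix \<rho>' :: "(real \<Rightarrow> 'f) \<Rightarrow> real \<Rightarrow> 'e" and Q :: "real \<Rightarrow> 'f"
    assume \<rho>': "is_L2_adjoint ?I ?J ?R \<rho>'" and Q: "Q \<in> square_integrable ?J"
    \<comment> \<open>The explicit \<open>S\<close> is one adjoint, so uniqueness carries both its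
      formula and its bound over to \<open>\<rho>'\<close>.\<close>
    have eq: "AE t in ?I. \<rho>' Q t = S Q t"
      by (rule is_L2_adjoint_unique[OF \<rho>' adjoint Q])
    from eq S_int[OF Q]
    show "AE t in ?I. integrable \<nu>\<^sub>0 (?a Q t) \<and> \<rho>' Q t = (\<integral>s. ?a Q t s \<partial>\<nu>\<^sub>0)"
      by eventually_elim (simp add: S_def)
    fix K' assume K': "K' \<in> {-K..T}"
    have "(\<integral>\<^sup>+ t\<in>{K'..T}. ennreal ((norm (\<rho>' Q t))\<^sup>2) \<partial>lborel) =
        (\<integral>\<^sup>+ t\<in>{K'..T}. ennreal ((norm (S Q t))\<^sup>2) \<partial>lborel)"
      using eq[unfolded AE_I] K'
      by (intro nn_integral_cong_AE) (auto elim!: eventually_mono simp: indicator_def)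
    then show "(\<integral>\<^sup>+ t\<in>{K'..T}. ennreal ((norm (\<rho>' Q t))\<^sup>2) \<partial>lborel)
        \<le> M * M\<^sub>0 * (\<integral>\<^sup>+ u\<in>{max 0 K'..T}. ennreal ((norm (Q u))\<^sup>2) \<partial>lborel)"
      using S_bound[OF Q K'] by simp
  qed (use R_int lin in auto)
qed

end
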